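(* Let $d\ge2$ and let $(X_n)$ be a positive recurrent rotor walk on $\mathbb{T}_d$ (i.e. $\mathbb{E}[\rho(v)]>d-1$) with i.i.d. random initial configuration. Let $\tau_0=0$ and $\tau_k=\inf\{n>\tau_{k-1}: X_n=o\}$ for $k\ge1$ (these are almost surely finite). Then $$\lim_{k\to\infty}\frac{|R_{\tau_k}|}{\tau_k}=\frac{d-1}{2\,\mathbb{E}[\rho(v)]}\quad\text{almost surely}.$$
   Context: Fix an integer $d\ge2$. Let $\widetilde{\mathbb{T}}_d$ be the rooted tree with root $r$ in which every vertex has exactly $d$ children, and let $\mathbb{T}_d$ be $\widetilde{\mathbb{T}}_d$ together with an extra vertex $o$ (the sink) joined by an edge to $r$. For $v\in\widetilde{\mathbb{T}}_d$ its $d+1$ neighbours are labelled $v^{(0)},v^{(1)},\dots,v^{(d)}$, where $v^{(0)}$ is the parent of $v$ (with $r^{(0)}=o$) and $v^{(1)},\dots,v^{(d)}$ are the children of $v$ in a fixed order. A rotor configuration is a map $\rho:\widetilde{\mathbb{T}}_d\to\{0,1,\dots,d\}$. The rotor walk $(X_n)_{n\ge0}$ with initial configuration $\rho_0=\rho$ starts at $X_0=r$; if $X_n=v\in\widetilde{\mathbb{T}}_d$ then $\rho_{n+1}(v)=\rho_n(v)+1 \pmod{d+1}$, $\rho_{n+1}(u)=\rho_n(u)$ for $u\neq v$, and $X_{n+1}=v^{(\rho_{n+1}(v))}$; if $X_n=o$ then $X_{n+1}=r$ and the rotors are unchanged. The initial configuration is random: the $\rho(v)$, $v\in\widetilde{\mathbb{T}}_d$,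 are i.i.d. with $\mathbb{P}[\rho(v)=j]=r_j$ for $j=0,\dots,d$, $\sum_j r_j=1$. The range is $R_n=\{X_0,\dots,X_n\}\setminus\{o\}$ and $|R_n|$ is its cardinality. *)

theory Defs
  imports "HOL-Probability.Probability"
begin

text \<open>Vertices of the d-ary tree: words over {1..d}; the root r is [],
  the i-th child of v is v @ [i], the parent of v \<noteq> [] is butlast v.
  Vertices of T_d (with sink) are nat list option; None is the sink o.\<close>

definition tree_vertices :: "nat \<Rightarrow> nat list set" where
  "tree_vertices d = {v. set v \<subseteq> {1..d}}"

definition nbr :: "nat list \<Rightarrow> nat \<Rightarrow> nat list option" where
  "nbr v i = (if i = 0 then (if v = [] then None else Some (butlast v)) else Some (v @ [i]))"

fun rotor_step :: "nat \<Rightarrow> nat list option \<times> (nat list \<Rightarrow> nat) \<Rightarrow> nat list option \<times> (nat list \<Rightarrow> nat)" where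
  "rotor_step d (None, \<rho>) = (Some [], \<rho>)"
| "rotor_step d (Some v, \<rho>) =
     (let j = (\<rho> v + 1) mod (d + 1) in (nbr v j, \<rho>(v := j)))"

definition rotor_state :: "nat \<Rightarrow> (nat list \<Rightarrow> nat) \<Rightarrow> nat \<Rightarrow> nat list option \<times> (nat list \<Rightarrow> nat)" where
  "rotor_state d \<rho> n = (rotor_step d ^^ n) (Some [], \<rho>)"

definition rotor_walk :: "nat \<Rightarrow> (nat list \<Rightarrow> nat) \<Rightarrow> nat \<Rightarrow> nat list option" where
  "rotor_walk d \<rho> n = fst (rotor_state d \<rho> n)"

fun return_time :: "nat \<Rightarrow> (nat list \<Rightarrow> nat) \<Rightarrow> nat \<Rightarrow> nat" where
  "return_time d \<rho> 0 = 0"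
| "return_time d \<rho> (Suc k) = (LEAST n. return_time d \<rho> k < n \<and> rotor_walk d \<rho> n = None)"

definition rotor_range :: "nat \<Rightarrow> (nat list \<Rightarrow> nat) \<Rightarrow> nat \<Rightarrow> nat list set" where
  "rotor_range d \<rho> n = {v. \<exists>i\<le>n. rotor_walk d \<rho> i = Some v}"

definition iid_rotor_config :: "nat \<Rightarrow> nat pmf \<Rightarrow> (nat list \<Rightarrow> nat) measure" where
  "iid_rotor_config d p = PiM (tree_vertices d) (\<lambda>_. measure_pmf p)"

end

theory Submission
  imports Defs "HOL-Library.Sublist" "HOL-Real_Asymp.Real_Asymp"
begin

text \<open>Balancing the departures from each visited vertex against its net rotor movement gives, at every
  visit \<open>\<tau>\<close> of the sink, the exact identity
  \<open>2 * (\<Sum>v\<in>R. \<rho> v) = (d - 1) * (\<tau> + 1) + 2 * k\<close>, where \<open>k\<close> is the number of sink visits up to and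
  including \<open>\<tau>\<close>. Whether a vertex is the next new one depends only on the rotors already seen, so
  the initial rotors listed in order of discovery are i.i.d., and a Chernoff bound with
  Borel-Cantelli shows that their averages converge to the mean of \<open>p\<close>. Dividing the identity by
  \<open>card R\<close> and \<open>\<tau>\<close> yields the limit, because successive excursions get longer and hence
  \<open>k / \<tau> \<longlonglongrightarrow> 0\<close>. The same law of large numbers rules out an infinite excursion.\<close>

section \<open>Deterministic properties of the walk\<close>

definition rotors :: "nat \<Rightarrow> (nat list \<Rightarrow> nat) \<Rightarrow> nat \<Rightarrow> nat list \<Rightarrow> nat" where
  "rotors d \<rho> n = snd (rotor_state d \<rho> n)"

text \<open>Time \<open>n\<close> itself is excluded: this counts departures from the sink during
  the first \<open>n\<close> steps.\<close>

definition sink_visits :: "nat \<Rightarrow> (nat list \<Rightarrow> nat) \<Rightarrow> nat \<Rightarrow> nat" where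
  "sink_visits d \<rho> n = card {i. i < n \<and> rotor_walk d \<rho> i = None}"

fun ancestors :: "nat list option \<Rightarrow> nat list set" where
  "ancestors None = {}"
| "ancestors (Some v) = {u. prefix u v}"

text \<open>Distance to the sink rather than to the root: it is 1 at the root, so every step of the
  walk changes it by exactly one.\<close>

fun depth :: "nat list option \<Rightarrow> nat" where
  "depth None = 0"
| "depth (Some v) = Suc (length v)"

lemma card_ancestors: "card (ancestors x) = depth x"
  by (cases x) (simp_all flip: set_prefixes_eq)

lemma prefix_butlast_iff: "v \<noteq> [] \<Longrightarrow> prefix u (butlast v) \<longleftrightarrow> prefix u v \<and> u \<noteq> v"
  by (cases v rule: rev_cases) auto

lemma rotor_state_Pair: "rotor_state d \<rho> n = (rotor_walk d \<rho> n, rotors d \<rho> n)"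
  by (simp add: rotor_walk_def rotors_def)

lemma walk_0 [simp]: "rotor_walk d \<rho> 0 = Some []"
  and rotors_0 [simp]: "rotors d \<rho> 0 = \<rho>"
  by (simp_all add: rotor_walk_def rotors_def rotor_state_def)

lemma rotor_state_Suc:
  "rotor_state d \<rho> (Suc n) = rotor_step d (rotor_walk d \<rho> n, rotors d \<rho> n)"
  by (simp add: rotor_state_def flip: rotor_state_Pair)

lemma walk_Suc:
  "rotor_walk d \<rho> (Suc n) = fst (rotor_step d (rotor_walk d \<rho> n, rotors d \<rho> n))"
  and rotors_Suc:
  "rotors d \<rho> (Suc n) = snd (rotor_step d (rotor_walk d \<rho> n, rotors d \<rho> n))"
  by (metis rotor_state_Pair rotor_state_Suc fst_conv snd_conv)+

text \<open>Position and rotors determine the future, so from any time at the root the walk is a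
  fresh walk with the current rotors. This carries facts about the first excursion over to later
  ones.\<close>

lemma rotor_state_restart:
  assumes "rotor_walk d \<rho> s = Some []"
  shows "rotor_state d \<rho> (s + n) = rotor_state d (rotors d \<rho> s) n"
proof -
  have "rotor_state d \<rho> (s + n) = (rotor_step d ^^ n) (rotor_state d \<rho> s)"
    by (subst add.commute) (simp add: rotor_state_def funpow_add)
  then show ?thesis
    using assms by (simp add: rotor_state_Pair[of d \<rho> s] rotor_state_def[of d "rotors d \<rho> s"])
qed

lemma walk_restart:
  assumes "rotor_walk d \<rho> s = Some []"
  shows "rotor_walk d (rotors d \<rho> s) n = rotor_walk d \<rho> (s + n)"
  using rotor_state_restart[OF assms, of n] by (simp add: rotor_walk_def)

lemma range_0 [simp]: "rotor_range d \<rho> 0 = {[]}"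
  by (auto simp: rotor_range_def)

lemma range_Suc:
  "rotor_range d \<rho> (Suc n) = rotor_range d \<rho> n \<union> set_option (rotor_walk d \<rho> (Suc n))"
  by (auto simp: rotor_range_def le_Suc_eq)

lemma finite_range [simp]: "finite (rotor_range d \<rho> n)"
  by (induction n) (simp_all add: range_Suc)

lemma range_mono: "m \<le> n \<Longrightarrow> rotor_range d \<rho> m \<subseteq> rotor_range d \<rho> n"
  unfolding rotor_range_def using order_trans by blast

lemma card_range_mono: "m \<le> n \<Longrightarrow> card (rotor_range d \<rho> m) \<le> card (rotor_range d \<rho> n)"
  by (intro card_mono range_mono) simp_all

lemma card_range_pos: "card (rotor_range d \<rho> n) > 0"
  using card_range_mono[of 0 n d \<rho>] by simp

lemma walk_in_range: "rotor_walk d \<rho> n = Some v \<Longrightarrow> v \<in> rotor_range d \<rho> n"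
  by (auto simp: rotor_range_def)

lemma root_in_range [simp]: "[] \<in> rotor_range d \<rho> n"
  using range_mono[of 0 n d \<rho>] by simp

lemma sink_visits_Suc:
  "sink_visits d \<rho> (Suc n) = sink_visits d \<rho> n + (if rotor_walk d \<rho> n = None then 1 else 0)"
proof -
  have "{i. i < Suc n \<and> rotor_walk d \<rho> i = None} =
      (if rotor_walk d \<rho> n = None then insert n {i. i < n \<and> rotor_walk d \<rho> i = None}
       else {i. i < n \<and> rotor_walk d \<rho> i = None})"
    by (auto simp: less_Suc_eq)
  then show ?thesis by (simp add: sink_visits_def)
qed

lemma rotors_unvisited: "v \<notin> rotor_range d \<rho> n \<Longrightarrow> rotors d \<rho> n v = \<rho> v"
proof (induction n)
  case (Suc n)
  then show ?case
    using walk_in_range[of d \<rho> n]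
    by (cases "rotor_walk d \<rho> n") (auto simp: rotors_Suc range_Suc Let_def)
qed simp

text \<open>Only tree vertices are constrained because a point of the product space takes the value
  \<open>undefined\<close> elsewhere.\<close>

locale rotor_config =
  fixes d :: nat and \<rho> :: "nat list \<Rightarrow> nat"
  assumes rotor_le: "v \<in> tree_vertices d \<Longrightarrow> \<rho> v \<le> d"
    and d_ge_2: "d \<ge> 2"
begin

lemma d_pos: "d \<ge> 1"
  using d_ge_2 by simp

abbreviation "X \<equiv> rotor_walk d \<rho>"
abbreviation "rot \<equiv> rotors d \<rho>"
abbreviation "R \<equiv> rotor_range d \<rho>"

lemma walk_in_tree: "X n = Some v \<Longrightarrow> v \<in> tree_vertices d"
proof (induction n arbitrary: v)
  case (Suc n)
  show ?case
  proof (cases "X n")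
    case None
    with Suc.prems show ?thesis by (auto simp: walk_Suc tree_vertices_def)
  next
    case (Some u)
    define j where "j = (rot n u + 1) mod (d + 1)"
    have "j \<le> d" unfolding j_def by (metis mod_less_divisor add_gr_0 less_one less_Suc_eq_le Suc_eq_plus1)
    moreover have "nbr u j = Some v" using Suc.prems Some by (simp add: walk_Suc Let_def j_def)
    ultimately show ?thesis using Suc.IH[OF Some]
      by (fastforce simp: nbr_def tree_vertices_def split: if_splits dest: in_set_butlastD)
  qed
qed (simp add: tree_vertices_def)

lemma range_subset_tree: "R n \<subseteq> tree_vertices d"
  using walk_in_tree by (auto simp: rotor_range_def)

lemma rotors_le: "v \<in> tree_vertices d \<Longrightarrow> rot n v \<le> d"
proof (induction n)
  case (Suc n)
  then show ?case
    by (cases "X n") (auto simp: rotors_Suc Let_def simp flip: less_Suc_eq_le)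
qed (simp add: rotor_le)

text \<open>A rotor never exceeds \<open>d\<close>, so reduction mod \<open>d + 1\<close> acts only
  at the value \<open>d\<close>; this wrap to 0 is the move to the parent.\<close>

lemma step_cases [consumes 0, case_names sink down up]:
  obtains "X n = None" "X (Suc n) = Some []" "rot (Suc n) = rot n"
  | v j where "X n = Some v" "rot n v = j" "Suc j \<le> d" "X (Suc n) = Some (v @ [Suc j])"
      "rot (Suc n) = (rot n)(v := Suc j)"
  | v where "X n = Some v" "rot n v = d" "rot (Suc n) = (rot n)(v := 0)"
      "X (Suc n) = (if v = [] then None else Some (butlast v))"
proof (cases "X n")
  case None
  then show ?thesis using that(1) by (simp add: walk_Suc rotors_Suc)
next
  case (Some v)
  have "rot n v \<le> d" using Some walk_in_tree rotors_le by blast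
  then consider "rot n v = d" | "Suc (rot n v) \<le> d" by linarith
  then show ?thesis
    by cases (use Some that(2)[of v] that(3)[of v]
        in \<open>simp_all add: walk_Suc rotors_Suc nbr_def Let_def\<close>)
qed

section \<open>Rotors along the current path and the conservation identity\<close>

lemma ancestors_in_range: "ancestors (X n) \<subseteq> R n"
proof (induction n)
  case (Suc n)
  show ?case
  proof (cases rule: step_cases[of n])
    case (up v)
    then show ?thesis using Suc by (auto simp: range_Suc prefix_butlast_iff)
  qed (use Suc in \<open>auto simp: range_Suc\<close>)
qed simp

lemma parent_in_range: "X n = Some v \<Longrightarrow> butlast v \<in> R n"
  using ancestors_in_range[of n] prefixeq_butlast[of v] by auto

lemma depth_le_card_range: "depth (X n) \<le> card (R n)"
  using card_mono[OF finite_range ancestors_in_range] by (simp add: card_ancestors)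

text \<open>A vertex leaves the path from the root to the current position only when the walk steps
  from it to its parent, and that step sets its rotor to 0. In particular all visited rotors are 0
  whenever the walk is at the sink.\<close>

lemma rotors_off_path: "v \<in> R n \<Longrightarrow> v \<notin> ancestors (X n) \<Longrightarrow> rot n v = 0"
proof (induction n)
  case (Suc n)
  show ?case
  proof (cases rule: step_cases[of n])
    case sink
    then show ?thesis using Suc by (auto simp: range_Suc)
  next
    case (down u j)
    then show ?thesis using Suc by (auto simp: range_Suc)
  next
    case (up u)
    then show ?thesis using Suc walk_in_range[of d \<rho> n]
      by (auto simp: range_Suc prefix_butlast_iff prefixeq_butlast split: if_splits)
  qed
qed simp

lemma sum_rotors_le: "(\<Sum>v\<in>R n. rot n v) \<le> d * depth (X n)"
proof -
  have "(\<Sum>v\<in>R n. rot n v) = (\<Sum>v\<in>ancestors (X n). rot n v)"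
    by (rule sum.mono_neutral_right) (auto simp: ancestors_in_range rotors_off_path)
  also have "\<dots> \<le> (\<Sum>v\<in>ancestors (X n). d)"
    using ancestors_in_range range_subset_tree by (intro sum_mono rotors_le) blast
  finally show ?thesis by (simp add: card_ancestors mult.commute)
qed

text \<open>A visited vertex left \<open>e\<close> times, \<open>u\<close> of them towards its parent, satisfies
  \<open>e + \<rho> v = (d + 1) * u + rot n v\<close>. Summing over the range, the total number of upward steps is
  eliminated through the depth of the current position.\<close>

lemma rotor_conservation:
  "2 * n + (d + 1) * depth (X n) + 2 * (\<Sum>v\<in>R n. \<rho> v) =
   (d + 1) * (n + 1) + 2 * sink_visits d \<rho> n + 2 * (\<Sum>v\<in>R n. rot n v)"
proof (induction n)
  case 0
  then show ?case by (simp add: sink_visits_def)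
next
  case (Suc n)
  show ?case
  proof (cases rule: step_cases[of n])
    case sink
    then have "R (Suc n) = R n" by (auto simp: range_Suc)
    then show ?thesis using Suc sink by (simp add: sink_visits_Suc)
  next
    case (down u j)
    let ?c = "u @ [Suc j]"
    have u: "u \<in> R n" using down walk_in_range by blast
    have sum_u: "(\<Sum>v\<in>R n. rot (Suc n) v) = Suc (\<Sum>v\<in>R n. rot n v)"
      using u down by (simp add: sum.remove[OF finite_range u])
    \<comment> \<open>A vertex entered for the first time still carries its initial rotor, hence
      contributes equally to both sums. The additive form avoids subtraction in
      \<open>nat\<close>.\<close>
    have "(\<Sum>v\<in>R (Suc n). rot (Suc n) v) + (\<Sum>v\<in>R n. \<rho> v) =
        Suc (\<Sum>v\<in>R n. rot n v) + (\<Sum>v\<in>R (Suc n). \<rho> v)"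
    proof (cases "?c \<in> R n")
      case True
      then have "R (Suc n) = R n" using down by (auto simp: range_Suc)
      then show ?thesis using sum_u by simp
    next
      case False
      then have "R (Suc n) = insert ?c (R n)" using down by (auto simp: range_Suc)
      moreover have "rot (Suc n) ?c = \<rho> ?c" using rotors_unvisited[OF False] down by simp
      ultimately show ?thesis using sum_u False by simp
    qed
    then show ?thesis using Suc down by (simp add: sink_visits_Suc algebra_simps)
  next
    case (up u)
    have u: "u \<in> R n" using up walk_in_range by blast
    have R: "R (Suc n) = R n" using up parent_in_range by (auto simp: range_Suc)
    have sum_u: "(\<Sum>v\<in>R n. rot (Suc n) v) + d = (\<Sum>v\<in>R n. rot n v)"
      using u up by (simp add: sum.remove[OF finite_range u])
    have "depth (X n) = Suc (depth (X (Suc n)))"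
      using up by simp
    then show ?thesis using Suc sum_u up d_pos by (simp add: R sink_visits_Suc algebra_simps)
  qed
qed

text \<open>Until the walk reaches the sink, every vertex is entered from its parent at most once.\<close>

lemma first_excursion:
  assumes "\<And>i. i \<le> n \<Longrightarrow> X i \<noteq> None"
  shows "(\<forall>v i. v @ [i] \<in> R n \<longrightarrow> v \<in> R n \<and> (v \<in> ancestors (X n) \<longrightarrow> i \<le> rot n v)) \<and>
    n + 1 + depth (X n) = 2 * card (R n)"
  using assms
proof (induction n)
  case (Suc n)
  have IH: "v @ [i] \<in> R n \<Longrightarrow> v \<in> R n" 
    "v @ [i] \<in> R n \<Longrightarrow> v \<in> ancestors (X n) \<Longrightarrow> i \<le> rot n v"
    "n + 1 + depth (X n) = 2 * card (R n)" for v i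
    using Suc by auto
  show ?case
  proof (cases rule: step_cases[of n])
    case sink
    then show ?thesis using Suc.prems[of n] by simp
  next
    case (down u j)
    let ?c = "u @ [Suc j]"
    have u: "u \<in> R n" using down walk_in_range by blast
    \<comment> \<open>Had the child been visited, the invariant would give
      \<open>Suc j \<le> rot n u\<close>, against \<open>rot n u = j\<close>.\<close>
    have new: "?c \<notin> R n"
      using IH(2)[of u "Suc j"] down by auto
    have R: "R (Suc n) = insert ?c (R n)" using down by (auto simp: range_Suc)
    have "?c @ [i] \<notin> R n" for i using IH(1) new by blast
    then show ?thesis
      using IH down new u unfolding R
      by (auto simp: le_Suc_eq)
  next
    case (up u)
    then have "u \<noteq> []" using Suc.prems[of "Suc n"] by auto
    then have R: "R (Suc n) = R n" using up parent_in_range by (auto simp: range_Suc)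
    \<comment> \<open>Time rises and depth falls by one while no vertex is new, so the count is
      preserved; a step down raises both sides by two.\<close>
    have "depth (X n) = Suc (depth (X (Suc n)))" using up \<open>u \<noteq> []\<close> by simp
    then show ?thesis
      using IH up \<open>u \<noteq> []\<close> unfolding R
      by (auto simp: prefix_butlast_iff)
  qed
qed simp

text \<open>Conservation with the crude bounds \<open>d\<close> on each rotor and
  \<open>card (R n)\<close> on the depth. Since \<open>d \<ge> 2\<close>, the range is unbounded
  whether or not the walk returns to the sink, so every stage of the exploration is reached.\<close>

lemma card_range_lower: "(d - 1) * n \<le> (3 * d + 1) * card (R n)"
proof -
  have "(\<Sum>v\<in>R n. \<rho> v) \<le> (\<Sum>v\<in>R n. d)"
    using range_subset_tree by (intro sum_mono rotor_le) blast
  then have S: "(\<Sum>v\<in>R n. \<rho> v) \<le> d * card (R n)" by (simp add: mult.commute)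
  have D: "(d + 1) * depth (X n) \<le> (d + 1) * card (R n)"
    by (rule mult_le_mono2[OF depth_le_card_range])
  have "(d - 1) * n + 2 * n = (d + 1) * n" using d_pos
    by (simp add: algebra_simps diff_mult_distrib flip: distrib_right)
  then have "(d - 1) * n \<le> (d + 1) * depth (X n) + 2 * (\<Sum>v\<in>R n. \<rho> v)"
    using rotor_conservation[of n] by (simp add: algebra_simps)
  also have "\<dots> \<le> (d + 1) * card (R n) + 2 * (d * card (R n))" using S D by linarith
  finally show ?thesis by (simp add: algebra_simps)
qed

lemma sum_at_sink:
  assumes "X n = None"
  shows "2 * (\<Sum>v\<in>R n. \<rho> v) = (d - 1) * n + (d + 1) + 2 * sink_visits d \<rho> n"
proof -
  have "(\<Sum>v\<in>R n. rot n v) = 0" using sum_rotors_le[of n] assms by simp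
  moreover have "(d - 1) * n + 2 * n = (d + 1) * n" using d_pos
    by (simp add: algebra_simps diff_mult_distrib flip: distrib_right)
  ultimately show ?thesis using rotor_conservation[of n] assms by simp
qed

end

section \<open>Independence along the exploration\<close>

text \<open>The shift \<open>Suc N\<close> makes index 0 belong to time 0, when the range is the
  root alone.\<close>

definition hit_time :: "nat \<Rightarrow> (nat list \<Rightarrow> nat) \<Rightarrow> nat \<Rightarrow> nat" where
  "hit_time d \<rho> N = (LEAST n. card (rotor_range d \<rho> n) = Suc N)"

definition new_vertex :: "nat \<Rightarrow> (nat list \<Rightarrow> nat) \<Rightarrow> nat \<Rightarrow> nat list" where
  "new_vertex d \<rho> N = the (rotor_walk d \<rho> (hit_time d \<rho> N))"

lemma card_range_Suc_le: "card (rotor_range d \<rho> (Suc n)) \<le> Suc (card (rotor_range d \<rho> n))"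
  by (cases "rotor_walk d \<rho> (Suc n)") (auto simp: range_Suc card_insert_if)

text \<open>A step reads only the rotor at the current position. Agreement on the vertices visited
  by time \<open>n\<close> therefore fixes the walk one step further, up to
  \<open>Suc n\<close>.\<close>

lemma walk_agree:
  assumes "\<And>v. v \<in> rotor_range d \<rho> n \<Longrightarrow> \<rho>' v = \<rho> v" and "m \<le> Suc n"
  shows "rotor_walk d \<rho>' m = rotor_walk d \<rho> m \<and>
    (\<forall>v. \<rho>' v = \<rho> v \<longrightarrow> rotors d \<rho>' m v = rotors d \<rho> m v)"
  using assms(2)
proof (induction m)
  case (Suc m)
  then have IH: "rotor_walk d \<rho>' m = rotor_walk d \<rho> m"
    "\<And>v. \<rho>' v = \<rho> v \<Longrightarrow> rotors d \<rho>' m v = rotors d \<rho> m v" by auto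
  show ?case
  proof (cases "rotor_walk d \<rho> m")
    case None
    then show ?thesis using IH by (simp add: walk_Suc rotors_Suc)
  next
    case (Some u)
    then have "u \<in> rotor_range d \<rho> n"
      using walk_in_range range_mono[of m n] Suc.prems by blast
    then have "rotors d \<rho>' m u = rotors d \<rho> m u" using assms(1) IH(2) by blast
    then show ?thesis using IH Some by (simp add: walk_Suc rotors_Suc Let_def)
  qed
qed simp

context rotor_config
begin

lemma card_range_ge: "\<exists>n0. \<forall>n\<ge>n0. N \<le> card (R n)"
proof (intro exI allI impI)
  fix n assume n: "(3 * d + 1) * N \<le> n"
  have "1 * n \<le> (d - 1) * n" using d_ge_2 by (intro mult_le_mono1) simp
  then have "n \<le> (d - 1) * n" by simp
  with n have "(3 * d + 1) * N \<le> (3 * d + 1) * card (R n)" using card_range_lower[of n] by linarith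
  then show "N \<le> card (R n)" by (metis mult_le_cancel1 add_gr_0 less_one)
qed

lemma card_range_at_top: "filterlim (\<lambda>n. card (R n)) at_top at_top"
  using card_range_ge by (auto simp: filterlim_at_top eventually_sequentially)

text \<open>The range gains at most one vertex per step, so its size skips no value.\<close>

lemma card_range_hit_time: "card (R (hit_time d \<rho> N)) = Suc N"
  unfolding hit_time_def
proof (rule LeastI_ex)
  let ?n = "LEAST n. Suc N \<le> card (R n)"
  have n: "Suc N \<le> card (R ?n)" using card_range_ge[of "Suc N"] by (auto intro: LeastI)
  have "card (R ?n) \<le> Suc N"
  proof (cases ?n)
    case (Suc m)
    then have "\<not> Suc N \<le> card (R m)" by (metis not_less_Least lessI)
    then show ?thesis using card_range_Suc_le[of d \<rho> m] Suc by simp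
  qed (simp add: range_0)
  with n have "card (R ?n) = Suc N" by (rule antisym[rotated])
  then show "\<exists>n. card (R n) = Suc N" by blast
qed

lemma new_vertex_card_range:
  assumes "X (Suc n) = Some v" "v \<notin> R n"
  shows "new_vertex d \<rho> (card (R n)) = v"
proof -
  have "hit_time d \<rho> (card (R n)) = Suc n"
    unfolding hit_time_def
  proof (rule Least_equality)
    show "card (R (Suc n)) = Suc (card (R n))" using assms by (simp add: range_Suc)
    show "Suc n \<le> y" if "card (R y) = Suc (card (R n))" for y
      using that card_range_mono[of y n d \<rho>] by (cases "Suc n \<le> y") auto
  qed
  then show ?thesis using assms by (simp add: new_vertex_def)
qed

lemma new_vertex_0: "new_vertex d \<rho> 0 = []"
proof -
  have "hit_time d \<rho> 0 = 0" unfolding hit_time_def by (rule Least_equality) auto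
  then show ?thesis by (simp add: new_vertex_def)
qed

lemma range_eq_new_vertices: "R n = new_vertex d \<rho> ` {..<card (R n)}"
proof (induction n)
  case 0
  then show ?case by (simp add: lessThan_Suc new_vertex_0)
next
  case (Suc n)
  show ?case
  proof (cases "set_option (X (Suc n)) \<subseteq> R n")
    case True
    then have "R (Suc n) = R n" by (auto simp: range_Suc)
    then show ?thesis using Suc by simp
  next
    case False
    then obtain v where v: "X (Suc n) = Some v" "v \<notin> R n" by (cases "X (Suc n)") auto
    then have R: "R (Suc n) = insert v (R n)" by (simp add: range_Suc)
    have "card (R (Suc n)) = Suc (card (R n))" using v by (simp add: R)
    then show ?thesis using Suc new_vertex_card_range[OF v] by (simp add: R lessThan_Suc)
  qed
qed

lemma inj_new_vertex: "inj (new_vertex d \<rho>)"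
proof (rule injI)
  fix i j assume eq: "new_vertex d \<rho> i = new_vertex d \<rho> j"
  let ?n = "hit_time d \<rho> (max i j)"
  have "card (new_vertex d \<rho> ` {..<card (R ?n)}) = card {..<card (R ?n)}"
    by (simp flip: range_eq_new_vertices)
  then have "inj_on (new_vertex d \<rho>) {..<card (R ?n)}" by (rule eq_card_imp_inj_on[rotated]) simp
  then show "i = j" using eq by (auto simp: card_range_hit_time inj_on_def)
qed

lemma new_vertex_in_tree: "new_vertex d \<rho> i \<in> tree_vertices d"
  using range_subset_tree[of "hit_time d \<rho> i"] range_eq_new_vertices[of "hit_time d \<rho> i"]
  by (auto simp: card_range_hit_time)

lemma sum_range: "(\<Sum>v\<in>R n. f v) = (\<Sum>i<card (R n). f (new_vertex d \<rho> i))"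
  by (subst range_eq_new_vertices) (simp add: sum.reindex inj_on_subset[OF inj_new_vertex])

lemma new_vertex_agree:
  assumes "\<And>i. i < N \<Longrightarrow> \<rho>' (new_vertex d \<rho> i) = \<rho> (new_vertex d \<rho> i)"
  shows "new_vertex d \<rho>' N = new_vertex d \<rho> N"
proof -
  let ?n = "hit_time d \<rho> N"
  have before: "card (R m) \<noteq> Suc N" if "m < ?n" for m
    using that not_less_Least unfolding hit_time_def by blast
  have walk: "rotor_walk d \<rho>' m = X m" if "m \<le> ?n" for m
  proof (cases ?n)
    case (Suc n)
    \<comment> \<open>Just before the hitting time the range consists of the first \<open>N\<close>
      vertices only, and the extra step in \<open>walk_agree\<close> covers the discovery
      itself.\<close>
    have "card (R n) = N"
      using before[of n] card_range_Suc_le[of d \<rho> n] card_range_mono[of n "Suc n" d \<rho>]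
        card_range_hit_time[of N] Suc by simp
    then have "\<rho>' v = \<rho> v" if "v \<in> R n" for v
      using that assms by (subst (asm) range_eq_new_vertices) auto
    from walk_agree[OF this] show ?thesis using \<open>m \<le> ?n\<close> Suc by auto
  qed (use that in simp)
  then have range: "rotor_range d \<rho>' m = R m" if "m \<le> ?n" for m
    using that by (auto simp: rotor_range_def)
  have "hit_time d \<rho>' N = ?n"
    unfolding hit_time_def[of d \<rho>']
  proof (rule Least_equality)
    show "card (rotor_range d \<rho>' ?n) = Suc N" using range card_range_hit_time by simp
    show "?n \<le> y" if "card (rotor_range d \<rho>' y) = Suc N" for y
      using that before[of y] range[of y] by (cases "y < ?n") auto
  qed
  then show ?thesis using walk by (simp add: new_vertex_def)
qed

end

text \<open>Each sequence of rotors is read along its own exploration, so equal values do not give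
  equal vertices at once. Inductively, common earlier vertices make the two configurations agree
  there, and this forces the next vertex to coincide.\<close>

lemma new_vertices_determined:
  assumes "rotor_config d \<sigma>"
    and "\<And>i. i < N \<Longrightarrow> \<rho> (new_vertex d \<rho> i) = \<sigma> (new_vertex d \<sigma> i)"
    and "i < N"
  shows "new_vertex d \<rho> i = new_vertex d \<sigma> i"
  using assms(3)
proof (induction i rule: less_induct)
  case (less i)
  show ?case
  proof (rule rotor_config.new_vertex_agree[OF assms(1)])
    fix j assume "j < i"
    then show "\<rho> (new_vertex d \<sigma> j) = \<sigma> (new_vertex d \<sigma> j)"
      using less assms(2)[of j] by simp
  qed
qed

text \<open>The moment generating function is 1 at 0 and its derivative there is the negative mean,
  so it drops below 1 for small positive \<open>t\<close>.\<close>

lemma pmf_exp_moment_less_1: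
  fixes p :: "'a pmf" and f :: "'a \<Rightarrow> real"
  assumes "finite A" "set_pmf p \<subseteq> A" and neg: "measure_pmf.expectation p f < 0"
  shows "\<exists>t>0. (\<Sum>j\<in>A. pmf p j * exp (t * f j)) < 1"
proof -
  let ?g = "\<lambda>t. \<Sum>j\<in>A. pmf p j * exp (t * f j)"
  have "(?g has_real_derivative (\<Sum>j\<in>A. pmf p j * f j)) (at 0)"
    by (auto intro!: derivative_eq_intros sum.cong)
  moreover have "(\<Sum>j\<in>A. pmf p j * f j) < 0"
    using neg assms(1,2) by (subst (asm) integral_measure_pmf_real[of A]) (auto simp: mult.commute)
  ultimately obtain e where "e > 0" "\<And>h. 0 < h \<Longrightarrow> h < e \<Longrightarrow> ?g (0 + h) < ?g 0"
    using DERIV_neg_dec_right by blast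
  from this(2)[of "e / 2"] this(1) show ?thesis
    using sum_pmf_eq_1[OF assms(1,2)] by (intro exI[of _ "e / 2"]) simp
qed

section \<open>Strong law of large numbers for the rotors in order of discovery\<close>

context
  fixes d :: nat and p :: "nat pmf"
  assumes d2: "d \<ge> 2" and supp: "set_pmf p \<subseteq> {0..d}"
begin

interpretation M: product_prob_space "\<lambda>_::nat list. measure_pmf p" "tree_vertices d"
  by unfold_locales

interpretation M: prob_space "iid_rotor_config d p"
  unfolding iid_rotor_config_def by (rule M.prob_space_axioms)

lemma AE_rotor_config: "AE \<rho> in iid_rotor_config d p. rotor_config d \<rho>"
proof -
  have "AE \<rho> in iid_rotor_config d p. \<forall>v\<in>tree_vertices d. \<rho> v \<in> set_pmf p"
    unfolding iid_rotor_config_def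
    by (subst AE_ball_countable)
      (auto intro!: AE_PiM_component measure_pmf.prob_space_axioms AE_pmfI)
  then show ?thesis by eventually_elim (use supp d2 in \<open>auto simp: rotor_config_def\<close>)
qed

text \<open>For a fixed \<open>\<sigma>\<close> the vertices are fixed and distinct, so the event is
  an ordinary cylinder of the product measure and its probability factors. This is where
  independence enters.\<close>

lemma cylinder_along_exploration:
  fixes N \<sigma>
  assumes "rotor_config d \<sigma>"
  defines "C \<equiv> {\<rho> \<in> space (iid_rotor_config d p). \<forall>v\<in>new_vertex d \<sigma> ` {..<N}. \<rho> v \<in> {\<sigma> v}}"
  shows "C \<in> sets (iid_rotor_config d p)"
    and "measure (iid_rotor_config d p) C = (\<Prod>i<N. pmf p (\<sigma> (new_vertex d \<sigma> i)))"
proof -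
  interpret rotor_config d \<sigma> by fact
  let ?J = "new_vertex d \<sigma> ` {..<N}"
  have J: "?J \<subseteq> tree_vertices d" using new_vertex_in_tree by blast
  show "C \<in> sets (iid_rotor_config d p)"
    unfolding C_def iid_rotor_config_def
  proof (intro sets.sets_Collect_finite_All)
    fix v assume "v \<in> ?J"
    then have "(\<lambda>\<rho>. \<rho> v) \<in> measurable (PiM (tree_vertices d) (\<lambda>_. measure_pmf p)) (measure_pmf p)"
      using J by (intro measurable_component_singleton) blast
    from measurable_sets[OF this, of "{\<sigma> v}"]
    have "(\<lambda>\<rho>. \<rho> v) -` {\<sigma> v} \<inter> space (PiM (tree_vertices d) (\<lambda>_. measure_pmf p))
        \<in> sets (PiM (tree_vertices d) (\<lambda>_. measure_pmf p))" by simp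
    also have "(\<lambda>\<rho>. \<rho> v) -` {\<sigma> v} \<inter> space (PiM (tree_vertices d) (\<lambda>_. measure_pmf p)) =
        {\<rho> \<in> space (PiM (tree_vertices d) (\<lambda>_. measure_pmf p)). \<rho> v \<in> {\<sigma> v}}" by blast
    finally show "{\<rho> \<in> space (PiM (tree_vertices d) (\<lambda>_. measure_pmf p)). \<rho> v \<in> {\<sigma> v}}
        \<in> sets (PiM (tree_vertices d) (\<lambda>_. measure_pmf p))"
      .
  qed simp
  have "emeasure (iid_rotor_config d p) C = (\<Prod>v\<in>?J. emeasure (measure_pmf p) {\<sigma> v})"
    unfolding C_def iid_rotor_config_def using J by (intro M.emeasure_PiM_Collect) auto
  also have "\<dots> = ennreal (\<Prod>v\<in>?J. pmf p (\<sigma> v))"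
    by (simp add: emeasure_pmf_single prod_ennreal)
  also have "(\<Prod>v\<in>?J. pmf p (\<sigma> v)) = (\<Prod>i<N. pmf p (\<sigma> (new_vertex d \<sigma> i)))"
    by (simp add: prod.reindex inj_on_subset[OF inj_new_vertex])
  finally show "measure (iid_rotor_config d p) C = (\<Prod>i<N. pmf p (\<sigma> (new_vertex d \<sigma> i)))"
    by (intro measure_eq_emeasure_eq_ennreal) (simp_all add: prod_nonneg)
qed

text \<open>Each possible history \<open>a\<close> of initial rotors along the exploration confines the
  configuration to a single cylinder, read off from any witness \<open>\<sigma>\<close> of that history;
  the tail is then bounded by a finite sum over histories.\<close>

lemma exploration_tail_bound:
  fixes f :: "nat \<Rightarrow> real"
  assumes t: "t > 0"
  shows "\<exists>A\<in>sets (iid_rotor_config d p).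
    measure (iid_rotor_config d p) A \<le> (\<Sum>j\<in>{0..d}. pmf p j * exp (t * f j)) ^ N \<and>
    (\<forall>\<rho>\<in>space (iid_rotor_config d p). rotor_config d \<rho> \<longrightarrow>
      (\<Sum>i<N. f (\<rho> (new_vertex d \<rho> i))) \<ge> 0 \<longrightarrow> \<rho> \<in> A)"
proof -
  let ?M = "iid_rotor_config d p"
  define H where "H = PiE {..<N} (\<lambda>_. {0..d})"
  define witness where "witness a \<sigma> \<longleftrightarrow> rotor_config d \<sigma> \<and> (\<forall>i<N. \<sigma> (new_vertex d \<sigma> i) = a i)"
    for a \<sigma>
  define B where "B = {a \<in> H. (\<Sum>i<N. f (a i)) \<ge> 0 \<and> (\<exists>\<sigma>. witness a \<sigma>)}"
  have "finite H" unfolding H_def by (intro finite_PiE) auto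
  then have B: "finite B" "B \<subseteq> H" by (auto simp: B_def)
  have "\<forall>a\<in>B. \<exists>\<sigma>. witness a \<sigma>" by (simp add: B_def)
  then have "\<exists>\<sigma>. \<forall>a\<in>B. witness a (\<sigma> a)" by (rule bchoice)
  then obtain \<sigma> where \<sigma>: "\<And>a. a \<in> B \<Longrightarrow> witness a (\<sigma> a)" by blast
  define C where "C a = {\<rho> \<in> space ?M. \<forall>v\<in>new_vertex d (\<sigma> a) ` {..<N}. \<rho> v \<in> {\<sigma> a v}}" for a
  have C: "C a \<in> sets ?M" "measure ?M (C a) = (\<Prod>i<N. pmf p (a i))" if "a \<in> B" for a
  proof -
    have "rotor_config d (\<sigma> a)" "\<forall>i<N. \<sigma> a (new_vertex d (\<sigma> a) i) = a i"
      using \<sigma>[OF that] by (simp_all add: witness_def)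
    then show "C a \<in> sets ?M" "measure ?M (C a) = (\<Prod>i<N. pmf p (a i))"
      using cylinder_along_exploration[of "\<sigma> a" N] by (simp_all add: C_def)
  qed
  show ?thesis
  proof (intro bexI conjI ballI impI)
    show "(\<Union>a\<in>B. C a) \<in> sets ?M" using C B by (intro sets.finite_UN) auto
    have "measure ?M (\<Union>a\<in>B. C a) \<le> (\<Sum>a\<in>B. measure ?M (C a))"
      using C B by (intro M.finite_measure_subadditive_finite) auto
    also have "\<dots> = (\<Sum>a\<in>B. \<Prod>i<N. pmf p (a i))" using C by simp
    also have "\<dots> \<le> (\<Sum>a\<in>B. \<Prod>i<N. pmf p (a i) * exp (t * f (a i)))"
    proof (rule sum_mono)
      fix a assume "a \<in> B"
      \<comment> \<open>Exponential Markov inequality, applied to each history separately: a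
        nonnegative sum makes the exponential factor at least 1.\<close>
      then have "0 \<le> t * (\<Sum>i<N. f (a i))" using t by (simp add: B_def)
      then have "1 \<le> exp (\<Sum>i<N. t * f (a i))" by (simp add: sum_distrib_left)
      then have "(\<Prod>i<N. pmf p (a i)) * 1 \<le> (\<Prod>i<N. pmf p (a i)) * exp (\<Sum>i<N. t * f (a i))"
        by (intro mult_left_mono prod_nonneg) auto
      then show "(\<Prod>i<N. pmf p (a i)) \<le> (\<Prod>i<N. pmf p (a i) * exp (t * f (a i)))"
        by (simp add: exp_sum prod.distrib)
    qed
    also have "\<dots> \<le> (\<Sum>a\<in>H. \<Prod>i<N. pmf p (a i) * exp (t * f (a i)))"
      using B \<open>finite H\<close> by (intro sum_mono2 prod_nonneg) auto
    \<comment> \<open>Over the full set of histories the sum of products factors into a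
      power.\<close>
    also have "\<dots> = (\<Sum>j\<in>{0..d}. pmf p j * exp (t * f j)) ^ N"
      unfolding H_def by (subst prod_sum_PiE[symmetric]) auto
    finally show "measure ?M (\<Union>a\<in>B. C a) \<le> (\<Sum>j\<in>{0..d}. pmf p j * exp (t * f j)) ^ N" .
    fix \<rho> assume \<rho>: "\<rho> \<in> space ?M" "rotor_config d \<rho>" "(\<Sum>i<N. f (\<rho> (new_vertex d \<rho> i))) \<ge> 0"
    define a where "a = restrict (\<lambda>i. \<rho> (new_vertex d \<rho> i)) {..<N}"
    interpret rotor_config d \<rho> by fact
    have "a \<in> H" using new_vertex_in_tree rotor_le by (auto simp: H_def a_def)
    moreover have "witness a \<rho>" using \<rho> by (simp add: witness_def a_def)
    ultimately have "a \<in> B" using \<rho> by (auto simp: B_def a_def)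
    then have w: "rotor_config d (\<sigma> a)"
      and eq: "\<And>i. i < N \<Longrightarrow> \<rho> (new_vertex d \<rho> i) = \<sigma> a (new_vertex d (\<sigma> a) i)"
      using \<sigma>[of a] by (auto simp: witness_def a_def)
    have "\<rho> (new_vertex d (\<sigma> a) i) = \<sigma> a (new_vertex d (\<sigma> a) i)" if "i < N" for i
      using new_vertices_determined[OF w eq that] eq[OF that] by simp
    then have "\<rho> \<in> C a" using \<rho> by (auto simp: C_def)
    with \<open>a \<in> B\<close> show "\<rho> \<in> (\<Union>a\<in>B. C a)" by blast
  qed
qed

text \<open>The tail probabilities are dominated by a geometric series, so by Borel-Cantelli the sum
  is nonnegative for only finitely many \<open>N\<close> almost surely.\<close>

lemma AE_exploration_sum_neg:
  fixes f :: "nat \<Rightarrow> real"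
  assumes "measure_pmf.expectation p f < 0"
  shows "AE \<rho> in iid_rotor_config d p. \<forall>\<^sub>F N in sequentially. (\<Sum>i<N. f (\<rho> (new_vertex d \<rho> i))) < 0"
proof -
  obtain t where t: "t > 0" "(\<Sum>j\<in>{0..d}. pmf p j * exp (t * f j)) < 1"
    using pmf_exp_moment_less_1[OF _ supp assms] by auto
  define q where "q = (\<Sum>j\<in>{0..d}. pmf p j * exp (t * f j))"
  have q: "0 \<le> q" "q < 1" using t by (auto simp: q_def intro!: sum_nonneg)
  obtain A where A: "\<And>N. A N \<in> sets (iid_rotor_config d p)"
      "\<And>N. measure (iid_rotor_config d p) (A N) \<le> q ^ N"
      "\<And>N \<rho>. \<rho> \<in> space (iid_rotor_config d p) \<Longrightarrow> rotor_config d \<rho> \<Longrightarrow>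
        (\<Sum>i<N. f (\<rho> (new_vertex d \<rho> i))) \<ge> 0 \<Longrightarrow> \<rho> \<in> A N"
    using exploration_tail_bound[OF t(1), of f] unfolding q_def by metis
  have "summable (\<lambda>N. measure (iid_rotor_config d p) (A N))"
    by (rule summable_comparison_test'[OF summable_geometric[of q]]) (use q A in auto)
  then have "AE \<rho> in iid_rotor_config d p.
      \<forall>\<^sub>F N in sequentially. \<rho> \<in> space (iid_rotor_config d p) - A N"
    using A by (intro borel_cantelli_AE1) (auto simp: M.emeasure_eq_measure)
  with AE_rotor_config show ?thesis
  proof eventually_elim
    case (elim \<rho>)
    show ?case using elim(2) by eventually_elim (use elim(1) A(3)[of \<rho>] in \<open>meson Diff_iff not_less\<close>)
  qed
qed

lemma AE_exploration_mean:
  "AE \<rho> in iid_rotor_config d p.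
    (\<lambda>N. (\<Sum>i<N. real (\<rho> (new_vertex d \<rho> i))) / real N) \<longlonglongrightarrow> measure_pmf.expectation p real"
proof -
  define \<mu> where "\<mu> = measure_pmf.expectation p real"
  have [simp]: "integrable (measure_pmf p) real"
    using supp by (intro integrable_measure_pmf_finite) (auto intro: finite_subset)
  \<comment> \<open>The shift by \<open>1 / Suc m\<close> makes the means of both deviations
    strictly negative, and countably many tolerances suffice for convergence.\<close>
  have "AE \<rho> in iid_rotor_config d p. \<forall>m::nat.
      (\<forall>\<^sub>F N in sequentially. (\<Sum>i<N. real (\<rho> (new_vertex d \<rho> i)) - \<mu> - 1 / Suc m) < 0) \<and>
      (\<forall>\<^sub>F N in sequentially. (\<Sum>i<N. \<mu> - real (\<rho> (new_vertex d \<rho> i)) - 1 / Suc m) < 0)"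
    unfolding AE_all_countable
    by (intro allI AE_conjI AE_exploration_sum_neg) (simp_all add: \<mu>_def)
  then show ?thesis
  proof eventually_elim
    case (elim \<rho>)
    let ?S = "\<lambda>N. \<Sum>i<N. real (\<rho> (new_vertex d \<rho> i))"
    have "\<forall>\<^sub>F N in sequentially. dist (?S N / real N) \<mu> < e" if e: "e > 0" for e
    proof -
      obtain m where m: "1 / real (Suc m) < e"
        using reals_Archimedean[OF e] by (auto simp: inverse_eq_divide)
      from elim have "\<forall>\<^sub>F N in sequentially. (\<Sum>i<N. real (\<rho> (new_vertex d \<rho> i)) - \<mu> - 1 / Suc m) < 0"
        "\<forall>\<^sub>F N in sequentially. (\<Sum>i<N. \<mu> - real (\<rho> (new_vertex d \<rho> i)) - 1 / Suc m) < 0"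
        by blast+
      with eventually_gt_at_top[of 0] show ?thesis
      proof eventually_elim
        case (elim N)
        define c where "c = 1 / real (Suc m)"
        have "\<bar>?S N - \<mu> * N\<bar> < c * N"
          using elim unfolding c_def[symmetric] by (simp add: sum_subtractf sum.distrib abs_less_iff algebra_simps)
        moreover have "?S N / N - \<mu> = (?S N - \<mu> * N) / N" using elim by (simp add: field_simps)
        ultimately have "\<bar>?S N / N - \<mu>\<bar> < c" using elim by (simp add: field_simps)
        then show ?case using m by (simp add: dist_real_def c_def)
      qed
    qed
    then show ?case unfolding \<mu>_def[symmetric] by (rule tendstoI)
  qed
qed

end

section \<open>Return times\<close>

context rotor_config
begin

lemma walk_from_sink:
  assumes "X n = None"
  shows "X (Suc n) = Some []" "rot (Suc n) = rot n"
  using assms by (simp_all add: walk_Suc rotors_Suc)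

lemma rotors_at_sink: "X n = None \<Longrightarrow> v \<in> R n \<Longrightarrow> rot n v = 0"
  using rotors_off_path by simp

text \<open>A rotor at 0 advances to 1 and sends the walk to the first child. The second conjunct,
  that rotors further down the branch are still 0, drives the induction.\<close>

lemma descend_leftmost:
  assumes "X m = Some []" "\<And>i. i < k \<Longrightarrow> rot m (replicate i 1) = 0" and "j \<le> k"
  shows "X (m + j) = Some (replicate j 1) \<and> (\<forall>i. j \<le> i \<longrightarrow> i < k \<longrightarrow> rot (m + j) (replicate i 1) = 0)"
  using assms(3)
proof (induction j)
  case (Suc j)
  then have IH: "X (m + j) = Some (replicate j 1)"
    "\<And>i. j \<le> i \<Longrightarrow> i < k \<Longrightarrow> rot (m + j) (replicate i 1) = 0" by auto
  have "rot (m + j) (replicate j 1) = 0" using IH(2)[of j] Suc.prems by simp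
  then have X: "X (Suc (m + j)) = Some (replicate j 1 @ [1])"
    and rot: "rot (Suc (m + j)) = (rot (m + j))(replicate j 1 := 1)"
    using IH(1) d_ge_2 by (simp_all add: walk_Suc rotors_Suc nbr_def)
  have "replicate i (1::nat) \<noteq> replicate j 1" if "Suc j \<le> i" for i
    using that by (metis length_replicate not_less_eq_eq order_refl)
  then show ?case
    using X rot IH(2) by (auto simp: replicate_append_same)
qed (use assms in simp)

lemma sink_visits_bounded:
  assumes "\<And>n. n \<ge> s \<Longrightarrow> X n \<noteq> None"
  shows "sink_visits d \<rho> n \<le> s"
proof -
  have "i < s" if "X i = None" for i
    using assms[of i] that by (cases "i < s") auto
  then have "card {i. i < n \<and> X i = None} \<le> card {..<s}"
    by (intro card_mono) auto
  then show ?thesis by (simp add: sink_visits_def)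
qed

text \<open>A final infinite excursion would satisfy \<open>n + depth (X n) \<le> 2 * card (R n) + O(1)\<close>, and
  then conservation keeps the mean initial rotor over the range below \<open>d - 1\<close>.\<close>

lemma mean_rotor_recurrent:
  assumes mean: "(\<lambda>N. (\<Sum>i<N. real (\<rho> (new_vertex d \<rho> i))) / real N) \<longlonglongrightarrow> \<mu>"
    and "\<mu> > real d - 1"
  shows "\<exists>n>m. X n = None"
proof (rule ccontr)
  assume "\<not> (\<exists>n>m. X n = None)"
  then have ex: "\<exists>s. \<forall>n\<ge>s. X n \<noteq> None" by (intro exI[of _ "Suc m"]) auto
  from ex[unfolded exists_least_iff[of "\<lambda>s. \<forall>n\<ge>s. X n \<noteq> None"]]
  obtain s where s: "\<And>n. n \<ge> s \<Longrightarrow> X n \<noteq> None"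
    and least: "\<And>s'. s' < s \<Longrightarrow> \<not> (\<forall>n\<ge>s'. X n \<noteq> None)" by blast
  \<comment> \<open>As \<open>s\<close> is the least time from which on the sink is avoided, it is
    either 0 or directly follows a sink visit. The tail is thus a walk from the root that never
    meets the sink, and \<open>first_excursion\<close> applies to it.\<close>
  have start: "X s = Some []"
  proof (cases s)
    case (Suc s')
    then have "\<not> (\<forall>n\<ge>s'. X n \<noteq> None)" using least by blast
    then have "X s' = None" using s Suc by (metis le_antisym not_less_eq_eq)
    then show ?thesis using walk_from_sink Suc by simp
  qed simp
  interpret S: rotor_config d "rot s"
    using rotors_le d_ge_2 by unfold_locales
  define C where "C = (real d - 1) * s + (d + 1) + 2 * s"
  have bound: "(\<Sum>v\<in>R (s + i). real (\<rho> v)) / card (R (s + i)) \<le>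
      real d - 1 + C / (2 * card (R (s + i)))" for i
  proof -
    let ?n = "s + i" let ?D = "depth (X ?n)" let ?S = "\<Sum>v\<in>R ?n. \<rho> v"
    have "i + 1 + ?D = 2 * card (S.R i)"
      using S.first_excursion[of i] s by (simp add: walk_restart[OF start])
    moreover have "S.R i \<subseteq> R ?n"
      unfolding rotor_range_def walk_restart[OF start] using add_le_cancel_left by blast
    then have "card (S.R i) \<le> card (R ?n)" by (intro card_mono) auto
    ultimately have n: "?n + ?D \<le> s + 2 * card (R ?n)" by simp
    have "sink_visits d \<rho> ?n \<le> s" using s by (rule sink_visits_bounded)
    then have "2 * ?n + (d + 1) * ?D + 2 * ?S \<le> (d + 1) * (?n + 1) + 2 * s + 2 * (d * ?D)"
      using rotor_conservation[of ?n] sum_rotors_le[of ?n] by linarith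
    then have "real (2 * ?n + (d + 1) * ?D + 2 * ?S) \<le> real ((d + 1) * (?n + 1) + 2 * s + 2 * (d * ?D))"
      by (simp only: of_nat_le_iff)
    \<comment> \<open>The bound \<open>d * ?D\<close> on the current rotors leaves
      \<open>(d - 1) * ?D\<close>, which joins \<open>(d - 1) * ?n\<close>; the excursion count then
      bounds \<open>?n + ?D\<close>. The constant \<open>C\<close> collects the terms free of
      \<open>i\<close>.\<close>
    then have "2 * real ?S \<le> (real d - 1) * real (?n + ?D) + (d + 1) + 2 * s"
      by (simp add: algebra_simps)
    also have "(real d - 1) * real (?n + ?D) \<le> (real d - 1) * real (s + 2 * card (R ?n))"
      using n d_ge_2 by (intro mult_left_mono of_nat_mono) auto
    finally have "2 * real ?S \<le> 2 * (real d - 1) * card (R ?n) + C"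
      by (simp add: C_def algebra_simps)
    then have "2 * real ?S / (2 * card (R ?n)) \<le> (2 * (real d - 1) * card (R ?n) + C) / (2 * card (R ?n))"
      by (rule divide_right_mono) simp
    also have "\<dots> = real d - 1 + C / (2 * card (R ?n))"
      using card_range_pos[of d \<rho> ?n] by (subst add_divide_distrib) force
    finally show ?thesis by simp
  qed
  have card: "filterlim (\<lambda>i. card (R (s + i))) sequentially sequentially"
    using filterlim_compose[OF card_range_at_top filterlim_add_const_nat_at_top[of s]]
    by (simp add: add.commute)
  have "(\<lambda>i. (\<Sum>v\<in>R (s + i). real (\<rho> v)) / card (R (s + i))) \<longlonglongrightarrow> \<mu>"
    using filterlim_compose[OF mean card] by (simp add: sum_range)
  moreover have "(\<lambda>N. real d - 1 + C / real (2 * N)) \<longlonglongrightarrow> real d - 1"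
    by real_asymp
  note filterlim_compose[OF this card]
  ultimately have "\<mu> \<le> real d - 1"
    by (rule LIMSEQ_le) (use bound in blast)
  with assms(2) show False by simp
qed

section \<open>Growth of the return times and the limit of the range ratio\<close>

abbreviation "\<tau> \<equiv> return_time d \<rho>"

context
  assumes recurrent: "\<And>m. \<exists>n>m. X n = None"
begin

lemma return_time_Suc: "\<tau> k < \<tau> (Suc k)" "X (\<tau> (Suc k)) = None"
  and return_time_gap: "\<tau> k < n \<Longrightarrow> n < \<tau> (Suc k) \<Longrightarrow> X n \<noteq> None"
  using LeastI_ex[OF recurrent[of "\<tau> k"]]
    not_less_Least[of n "\<lambda>n. \<tau> k < n \<and> X n = None"] by auto

text \<open>Between consecutive return times there is no sink visit, so each visit before
  \<open>\<tau> k\<close> is a return time of index below \<open>k\<close>.\<close>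

lemma sink_visits_return_time: "sink_visits d \<rho> (\<tau> k) \<le> k"
proof -
  have sub: "{i. i < \<tau> k \<and> X i = None} \<subseteq> \<tau> ` {..<k}"
  proof (induction k)
    case (Suc k)
    show ?case
    proof
      fix i assume i: "i \<in> {i. i < \<tau> (Suc k) \<and> X i = None}"
      then have "i \<le> \<tau> k" using return_time_gap[of k i] by (auto simp: not_le[symmetric])
      then show "i \<in> \<tau> ` {..<Suc k}" using Suc i by (cases "i = \<tau> k") (auto simp: lessThan_Suc)
    qed
  qed simp
  have "card {i. i < \<tau> k \<and> X i = None} \<le> card (\<tau> ` {..<k})" using sub by (intro card_mono) auto
  also have "\<dots> \<le> k" using card_image_le[of "{..<k}" \<tau>] by simp
  finally show ?thesis by (simp add: sink_visits_def)
qed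

text \<open>After a return all visited rotors vanish, so each excursion descends one level further
  along the leftmost branch than the previous one.\<close>

lemma excursion_start:
  assumes "\<And>i. i < k \<Longrightarrow> replicate i 1 \<in> R (\<tau> k)" and "k > 0" and "j \<le> k"
  shows "X (Suc (\<tau> k) + j) = Some (replicate j 1)" "Suc (\<tau> k) + j < \<tau> (Suc k)"
proof -
  \<comment> \<open>Positivity of \<open>k\<close> matters: \<open>\<tau> 0 = 0\<close> is a
    convention, and at that time the walk is at the root.\<close>
  obtain k' where "k = Suc k'" using assms(2) by (cases k) auto
  then have sink: "X (\<tau> k) = None" using return_time_Suc(2) by simp
  have X: "X (Suc (\<tau> k) + j) = Some (replicate j 1)" if "j \<le> k" for j
    using descend_leftmost[of "Suc (\<tau> k)" k j] walk_from_sink[OF sink] rotors_at_sink[OF sink]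
      assms(1) that by simp
  then show "X (Suc (\<tau> k) + j) = Some (replicate j 1)" using assms(3) .
  show "Suc (\<tau> k) + j < \<tau> (Suc k)"
  proof (rule ccontr)
    assume "\<not> ?thesis"
    moreover define i where "i = \<tau> (Suc k) - Suc (\<tau> k)"
    ultimately have i: "\<tau> (Suc k) = Suc (\<tau> k) + i" "i \<le> j"
      using return_time_Suc(1)[of k] by linarith+
    then show False using X[of i] assms(3) return_time_Suc(2)[of k] by simp
  qed
qed

lemma leftmost_branch_visited: "i < k \<Longrightarrow> replicate i 1 \<in> R (\<tau> k)"
proof (induction k arbitrary: i)
  case (Suc k)
  show ?case
  proof (cases "k = 0")
    case True
    then show ?thesis using Suc.prems by simp
  next
    case False
    then have "X (Suc (\<tau> k) + i) = Some (replicate i 1)" "Suc (\<tau> k) + i < \<tau> (Suc k)"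
      using excursion_start[OF Suc.IH, of i] Suc.prems by auto
    then show ?thesis using walk_in_range range_mono[OF less_imp_le] by blast
  qed
qed simp

text \<open>The excursion after \<open>\<tau> k\<close> lasts at least \<open>k\<close> steps
  because of its initial descent, and these lengths add up to \<open>k * (k - 1) / 2\<close>. Sink
  visits are thus negligible against time.\<close>

lemma return_time_quadratic: "k * k \<le> 2 * \<tau> k + k"
proof (induction k)
  case (Suc k)
  have "\<tau> k + k \<le> \<tau> (Suc k)"
  proof (cases "k = 0")
    case False
    then show ?thesis using excursion_start(2)[OF leftmost_branch_visited, of k k] by simp
  qed simp
  then show ?case using Suc by simp
qed simp

lemma return_time_ge: "k \<le> \<tau> k"
proof (induction k)
  case (Suc k)
  then show ?case using return_time_Suc(1)[of k] by simp
qed simp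

lemma return_time_at_top: "filterlim \<tau> at_top at_top"
  by (rule filterlim_at_top_mono[OF filterlim_ident]) (auto simp: return_time_ge)

text \<open>With \<open>S\<close> the sum of initial rotors over the range and \<open>N\<close> its
  size, the law of large numbers gives the limit of \<open>S / N\<close>, and conservation gives
  \<open>(d - 1) / 2\<close> as the limit of \<open>S / \<tau>\<close>; their quotient is
  \<open>N / \<tau>\<close>.\<close>

lemma range_ratio_tendsto:
  assumes mean: "(\<lambda>N. (\<Sum>i<N. real (\<rho> (new_vertex d \<rho> i))) / real N) \<longlonglongrightarrow> \<mu>"
    and "\<mu> > 0"
  shows "(\<lambda>k. real (card (R (\<tau> k))) / real (\<tau> k)) \<longlonglongrightarrow> (real d - 1) / (2 * \<mu>)"
proof -
  define N where "N k = real (card (R (\<tau> k)))" for k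
  define S where "S k = (\<Sum>v\<in>R (\<tau> k). real (\<rho> v))" for k
  have SN: "(\<lambda>k. S k / N k) \<longlonglongrightarrow> \<mu>"
    using filterlim_compose[OF mean filterlim_compose[OF card_range_at_top return_time_at_top]]
    by (simp add: sum_range S_def N_def)
  have N: "N k > 0" for k
    using card_range_pos by (simp add: N_def)
  have S: "2 * S k = (real d - 1) * \<tau> k + (d + 1) + 2 * sink_visits d \<rho> (\<tau> k)" if "k > 0" for k
  proof -
    obtain k' where "k = Suc k'" using \<open>k > 0\<close> by (cases k) auto
    then have "2 * (\<Sum>v\<in>R (\<tau> k). \<rho> v) = (d - 1) * \<tau> k + (d + 1) + 2 * sink_visits d \<rho> (\<tau> k)"
      using sum_at_sink return_time_Suc(2) by simp
    then have "real (2 * (\<Sum>v\<in>R (\<tau> k). \<rho> v)) = real ((d - 1) * \<tau> k + (d + 1) + 2 * sink_visits d \<rho> (\<tau> k))"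
      by (simp only:)
    then show ?thesis using d_pos by (simp add: S_def of_nat_diff)
  qed
  have "(\<lambda>k. real (sink_visits d \<rho> (\<tau> k)) / \<tau> k) \<longlonglongrightarrow> 0"
  proof (rule tendsto_sandwich[where f = "\<lambda>_. 0"])
    show "\<forall>\<^sub>F k in sequentially. real (sink_visits d \<rho> (\<tau> k)) / \<tau> k \<le> 4 / k"
      using eventually_ge_at_top[of 2]
    proof eventually_elim
      case (elim k)
      \<comment> \<open>From \<open>k = 2\<close> on, the linear term of the quadratic bound is at
        most half of \<open>k * k\<close>, which is where the constant 4 comes from.\<close>
      have "2 * k \<le> k * k" using elim by simp
      then have "k * k \<le> 4 * \<tau> k" using return_time_quadratic[of k] by linarith
      then have "real k * k \<le> 4 * \<tau> k" by (metis of_nat_le_iff of_nat_mult of_nat_numeral)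
      moreover have "\<tau> k > 0" using return_time_ge[of k] elim by linarith
      ultimately have "k / \<tau> k \<le> 4 / k" using elim by (simp add: field_simps)
      moreover have "real (sink_visits d \<rho> (\<tau> k)) / \<tau> k \<le> k / \<tau> k"
        using sink_visits_return_time[of k] by (intro divide_right_mono) auto
      ultimately show ?case by linarith
    qed
    show "(\<lambda>k. 4 / real k) \<longlonglongrightarrow> 0" by real_asymp
  qed auto
  moreover have "(\<lambda>k. real (d + 1) / \<tau> k) \<longlonglongrightarrow> 0"
    by (rule filterlim_compose[OF _ return_time_at_top]) real_asymp
  ultimately have "(\<lambda>k. (real d - 1) / 2 + (real (d + 1) / \<tau> k) / 2 + real (sink_visits d \<rho> (\<tau> k)) / \<tau> k)
      \<longlonglongrightarrow> (real d - 1) / 2 + 0 / 2 + 0"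
    by (intro tendsto_intros) auto
  then have "(\<lambda>k. S k / \<tau> k) \<longlonglongrightarrow> (real d - 1) / 2 + 0 / 2 + 0"
  proof (rule Lim_transform_eventually)
    show "\<forall>\<^sub>F k in sequentially. (real d - 1) / 2 + (real (d + 1) / \<tau> k) / 2 +
        real (sink_visits d \<rho> (\<tau> k)) / \<tau> k = S k / \<tau> k"
      using eventually_gt_at_top[of 0]
    proof eventually_elim
      case (elim k)
      then have "\<tau> k > 0" using return_time_ge[of k] by linarith
      moreover have "S k = (real d - 1) / 2 * \<tau> k + real (d + 1) / 2 + sink_visits d \<rho> (\<tau> k)"
        using S[OF elim] unfolding times_divide_eq_left of_nat_mult of_nat_numeral by argo
      ultimately show ?case by (simp add: add_divide_distrib)
    qed
  qed
  then have "(\<lambda>k. (S k / \<tau> k) / (S k / N k)) \<longlonglongrightarrow> ((real d - 1) / 2 + 0 / 2 + 0) / \<mu>"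
    using SN assms(2) by (intro tendsto_divide) auto
  then have "(\<lambda>k. N k / \<tau> k) \<longlonglongrightarrow> ((real d - 1) / 2 + 0 / 2 + 0) / \<mu>"
  proof (rule Lim_transform_eventually)
    show "\<forall>\<^sub>F k in sequentially. (S k / \<tau> k) / (S k / N k) = N k / \<tau> k"
      using eventually_gt_at_top[of 0]
    proof eventually_elim
      case (elim k)
      have "0 \<le> (real d - 1) * \<tau> k" using d_ge_2 by simp
      then have "S k > 0" using S[OF elim] by simp
      then show ?case using N[of k] by simp
    qed
  qed
  then show ?thesis by (simp add: N_def)
qed

end

end

theorem theorem3p2:
  fixes d :: nat and p :: "nat pmf"
  assumes "d \<ge> 2"
    and "set_pmf p \<subseteq> {0..d}"
    and "measure_pmf.expectation p real > real d - 1"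
  shows "AE \<rho> in iid_rotor_config d p.
           (\<forall>m. \<exists>n>m. rotor_walk d \<rho> n = None) \<and>
           ((\<lambda>k. real (card (rotor_range d \<rho> (return_time d \<rho> k))) / real (return_time d \<rho> k))
              \<longlonglongrightarrow> (real d - 1) / (2 * measure_pmf.expectation p real))"
proof -
  have mean_pos: "measure_pmf.expectation p real > 0" using assms by simp
  show ?thesis
    using AE_rotor_config[OF assms(1,2)] AE_exploration_mean[OF assms(1,2)]
  proof eventually_elim
    case (elim \<rho>)
    interpret rotor_config d \<rho> by fact
    have "\<exists>n>m. rotor_walk d \<rho> n = None" for m
      using mean_rotor_recurrent[OF elim(2) assms(3)] .
    then show ?case using range_ratio_tendsto[OF _ elim(2) mean_pos] by blast
  qed
qed

end
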